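(* Construct $\mathcal B=\{0\}\cup\{|t_{ij}|\}$ from all original admissible options. (a) If every unpruned fixed-$\theta$ search ($\theta\in\mathcal B$) is completed under the following conditions — branching covers every original option remaining after the integer-safe within-item dominance rule, a node is pruned only when it is infeasible or when its valid residual LP upper bound is no larger than the incumbent value, and every live node is eventually fathomed — then the best certified incumbent is a globally optimal $\Gamma$-robust solution. (b) Under time or node limits, if every $\theta\in\mathcal B$ has a valid upper-bound record $U_\theta$, then $$Z^{\mathrm{inc}}\ \le\ Z^{\mathrm{rob}}\ \le\ U^{\mathrm{global}}:=\max_{\theta\in\mathcal B}U_\theta .$$ Hence $U^{\mathrm{global}}-Z^{\mathrm{inc}}$ is a valid absolute anytime gap. (c) If even one original threshold lacks a valid record, no finite global gap is certified.
   Context: Data. There are items $i=1,\dots,n$. Item $i$ has a finite price menu $\mathcal X_i=\{x_{i,1},\dots,x_{i,m}\}\subset\mathbb R$, a reference price $a_i>0$, an exposure $\omega_i>0$, a nominal demand function $\hat g_i:\mathcal X_i\to\mathbb R_{>0}$ (monotone decreasing on the admissible range), and a relative tolerance $\sigma_i$. A margin target $\Delta>0$ and an integer budget $\Gamma\in\{0,1,\dots,n\}$ are given. The admissible menu $\mathcal X_i^{\mathrm{ad}}=\mathcal X_i\cap[(1-\sigma_i)a_i,(1+\sigma_i)a_i]$ is assumed nonempty. A variability parameter $\delta_i(x_i)$ is given with $0\le\delta_i(x_i)<\hat g_i(x_i)$ on $\mathcal X_i^{\mathrm{ad}}$. All option indices $j$ range over admissible ("original") options of item $i$. Arithmetic is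 exact. Robust problem. Put $s_i(x)=\omega_i(x-\Delta a_i)\hat g_i(x)$, $t_i(x)=\omega_i(x-\Delta a_i)\delta_i(x)$, $s_{ij}=s_i(x_{i,j})$, $t_{ij}=t_i(x_{i,j})$, $v_{ij}=\omega_i x_{i,j}\hat g_i(x_{i,j})$. Let $\beta(\bm{x},\Gamma)$ be the sum of the $\Gamma$ largest values among $\{|t_i(x_i)|\}_{i=1}^n$. $Z^{\mathrm{rob}}$ is the optimal value of maximizing $N(\bm{x})=\sum_i\omega_i x_i\hat g_i(x_i)$ over $x_i\in\mathcal X_i^{\mathrm{ad}}$ subject to $\sum_i s_i(x_i)-\beta(\bm{x},\Gamma)\ge0$ (the robust certificate); an optimal $\bm{x}$ is a globally optimal $\Gamma$-robust solution. Values of infeasible problems are $-\infty$. Fixed-$\theta$ MCKP. For $\theta\in\mathcal B$ let $s^\theta_{ij}=s_{ij}-\max\{0,|t_{ij}|-\theta\}$, choose $j^\theta(i)\in\arg\max_j s^\theta_{ij}$, and set $c^\theta_{ij}=s^\theta_{i,j^\theta(i)}-s^\theta_{ij}\ge0$, $C^\theta=\sum_i s^\theta_{i,j^\theta(i)}-\Gamma\theta$. The fixed-$\theta$ MCKP is: choose one option $j(i)$ per item to maximize $\sum_i v_{i,j(i)}$ subject to $\sum_i c^\theta_{i,j(i)}\le C^\theta$; its optimal value is $Z^{\mathrm{IP}}(\theta)$. Fixed-$\theta$ branch-and-bound. The integer-safe within-item dominance rule permits removing an original option only if another option of the same item has weakly smaller $c^\theta$ and weakly larger $v$, at least one strictly.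 A node fixes options for a subset $F$ of items, with total cost $C_F$ and value $V_F$, leaving the others free; an integer completion is a full selection agreeing with the node on $F$ and satisfying the capacity constraint; a node is infeasible if it has none. The residual LP upper bound is $V_F$ plus the optimum of the LP relaxation of the MCKP on the free items with capacity $C^\theta-C_F$. Branching picks a free item and creates one child per remaining option. The incumbent is the best feasible complete selection found so far, and every feasible completely fixed node is compared with it. A node is fathomed when pruned, or completely fixed and evaluated, or branched on with all children fathomed. Global algorithm. A certified incumbent is an admissible price vector found by the algorithm that passes the robust certificate $\sum_i s_i(x_i)-\beta(\bm{x},\Gamma)\ge0$; $Z^{\mathrm{inc}}$ is the value $N$ of the best one ($-\infty$ if none). Solutions found by the fixed-$\theta$ searches are offered as incumbents. A valid upper-bound record for $\theta$ is a number $U_\theta\in[-\infty,\infty)$ with $U_\theta\ge Z^{\mathrm{IP}}(\theta)$: thresholds with $C^\theta<0$ or infeasible fixed-$\theta$ LP receive $U_\theta=-\infty$; otherwise the initial record is the root LP value, and it may be replaced by a proven optimum or by the best remaining branch-and-bound upper bound. A threshold is pruned only when it has a valid record that cannot improve the global incumbent, i.e. $U_\theta\le Z^{\mathrm{inc}}$. A threshold without a valid record supplies no finite upper bound and is treated as $U_\theta=+\infty$ when forming $U^{\mathrm{global}}$. *)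

theory Defs
  imports "HOL-Library.FuncSet" "HOL-Library.Extended_Real"
begin

section \<open>Problem data\<close>

record pricing =
  num_items :: nat
  menu_size :: nat
  price :: "nat \<Rightarrow> nat \<Rightarrow> real"
  ref_price :: "nat \<Rightarrow> real"
  exposure :: "nat \<Rightarrow> real"
  demand :: "nat \<Rightarrow> real \<Rightarrow> real"
  tolerance :: "nat \<Rightarrow> real"
  variability :: "nat \<Rightarrow> real \<Rightarrow> real"
  margin :: real
  budget :: nat

definition items :: "pricing \<Rightarrow> nat set" where
  "items P = {1..num_items P}"

definition menu :: "pricing \<Rightarrow> nat \<Rightarrow> real set" where
  "menu P i = price P i ` {1..menu_size P}"

definition adm_menu :: "pricing \<Rightarrow> nat \<Rightarrow> real set" where
  "adm_menu P i = menu P i \<inter>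
     {(1 - tolerance P i) * ref_price P i .. (1 + tolerance P i) * ref_price P i}"

definition adm_opts :: "pricing \<Rightarrow> nat \<Rightarrow> nat set" where
  "adm_opts P i = {j \<in> {1..menu_size P}. price P i j \<in> adm_menu P i}"

definition pricing_data :: "pricing \<Rightarrow> bool" where
  "pricing_data P \<longleftrightarrow>
     margin P > 0 \<and> budget P \<le> num_items P \<and>
     (\<forall>i\<in>items P.
        ref_price P i > 0 \<and> exposure P i > 0 \<and>
        (\<forall>x\<in>menu P i. demand P i x > 0) \<and>
        monotone_on (adm_menu P i) (\<le>) (\<ge>) (demand P i) \<and>
        adm_menu P i \<noteq> {} \<and>
        (\<forall>x\<in>adm_menu P i. 0 \<le> variability P i x \<and> variability P i x < demand P i x))"


section \<open>The robust problem\<close>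

definition s_of :: "pricing \<Rightarrow> nat \<Rightarrow> real \<Rightarrow> real" where
  "s_of P i x = exposure P i * (x - margin P * ref_price P i) * demand P i x"

definition t_of :: "pricing \<Rightarrow> nat \<Rightarrow> real \<Rightarrow> real" where
  "t_of P i x = exposure P i * (x - margin P * ref_price P i) * variability P i x"

definition revenue :: "pricing \<Rightarrow> (nat \<Rightarrow> real) \<Rightarrow> real" where
  "revenue P x = (\<Sum>i\<in>items P. exposure P i * x i * demand P i (x i))"

definition protection :: "pricing \<Rightarrow> (nat \<Rightarrow> real) \<Rightarrow> real" where
  "protection P x =
     sum_list (take (budget P) (rev (sort (map (\<lambda>i. \<bar>t_of P i (x i)\<bar>) [1..<Suc (num_items P)]))))"

definition price_vectors :: "pricing \<Rightarrow> (nat \<Rightarrow> real) set" where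
  "price_vectors P = (\<Pi>\<^sub>E i\<in>items P. adm_menu P i)"

definition robust_certificate :: "pricing \<Rightarrow> (nat \<Rightarrow> real) \<Rightarrow> bool" where
  "robust_certificate P x \<longleftrightarrow> (\<Sum>i\<in>items P. s_of P i (x i)) - protection P x \<ge> 0"

definition robust_feasible :: "pricing \<Rightarrow> (nat \<Rightarrow> real) set" where
  "robust_feasible P = {x \<in> price_vectors P. robust_certificate P x}"

text \<open>Optimal values are suprema in \<^typ>\<open>ereal\<close>, so that infeasible problems have value
  \<^term>\<open>-\<infinity> :: ereal\<close>.\<close>

definition Z_rob :: "pricing \<Rightarrow> ereal" where
  "Z_rob P = (SUP x\<in>robust_feasible P. ereal (revenue P x))"

definition globally_optimal :: "pricing \<Rightarrow> (nat \<Rightarrow> real) \<Rightarrow> bool" where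
  "globally_optimal P x \<longleftrightarrow> is_arg_max (revenue P) (\<lambda>x. x \<in> robust_feasible P) x"


section \<open>The fixed-threshold multiple-choice knapsack problem\<close>

definition s_opt :: "pricing \<Rightarrow> nat \<Rightarrow> nat \<Rightarrow> real" where
  "s_opt P i j = s_of P i (price P i j)"

definition t_opt :: "pricing \<Rightarrow> nat \<Rightarrow> nat \<Rightarrow> real" where
  "t_opt P i j = t_of P i (price P i j)"

definition v_opt :: "pricing \<Rightarrow> nat \<Rightarrow> nat \<Rightarrow> real" where
  "v_opt P i j = exposure P i * price P i j * demand P i (price P i j)"

definition thresholds :: "pricing \<Rightarrow> real set" where
  "thresholds P = {0} \<union> {\<bar>t_opt P i j\<bar> | i j. i \<in> items P \<and> j \<in> adm_opts P i}"

definition s_theta :: "pricing \<Rightarrow> real \<Rightarrow> nat \<Rightarrow> nat \<Rightarrow> real" where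
  "s_theta P \<theta> i j = s_opt P i j - max 0 (\<bar>t_opt P i j\<bar> - \<theta>)"

text \<open>The choice of a maximizing option per item is left arbitrary: \<open>r\<close> below is any such choice.\<close>

definition reference_choice :: "pricing \<Rightarrow> real \<Rightarrow> (nat \<Rightarrow> nat) \<Rightarrow> bool" where
  "reference_choice P \<theta> r \<longleftrightarrow>
     (\<forall>i\<in>items P. is_arg_max (s_theta P \<theta> i) (\<lambda>j. j \<in> adm_opts P i) (r i))"

definition cost :: "pricing \<Rightarrow> real \<Rightarrow> (nat \<Rightarrow> nat) \<Rightarrow> nat \<Rightarrow> nat \<Rightarrow> real" where
  "cost P \<theta> r i j = s_theta P \<theta> i (r i) - s_theta P \<theta> i j"

definition capacity :: "pricing \<Rightarrow> real \<Rightarrow> (nat \<Rightarrow> nat) \<Rightarrow> real" where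
  "capacity P \<theta> r = (\<Sum>i\<in>items P. s_theta P \<theta> i (r i)) - real (budget P) * \<theta>"

definition selections :: "pricing \<Rightarrow> (nat \<Rightarrow> nat) set" where
  "selections P = (\<Pi>\<^sub>E i\<in>items P. adm_opts P i)"

definition sel_value :: "pricing \<Rightarrow> (nat \<Rightarrow> nat) \<Rightarrow> real" where
  "sel_value P h = (\<Sum>i\<in>items P. v_opt P i (h i))"

definition mckp_feasible :: "pricing \<Rightarrow> real \<Rightarrow> (nat \<Rightarrow> nat) \<Rightarrow> (nat \<Rightarrow> nat) set" where
  "mckp_feasible P \<theta> r =
     {h \<in> selections P. (\<Sum>i\<in>items P. cost P \<theta> r i (h i)) \<le> capacity P \<theta> r}"

definition Z_IP :: "pricing \<Rightarrow> real \<Rightarrow> (nat \<Rightarrow> nat) \<Rightarrow> ereal" where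
  "Z_IP P \<theta> r = (SUP h\<in>mckp_feasible P \<theta> r. ereal (sel_value P h))"


section \<open>Fixed-threshold branch-and-bound\<close>

definition dominates :: "pricing \<Rightarrow> real \<Rightarrow> (nat \<Rightarrow> nat) \<Rightarrow> nat \<Rightarrow> nat \<Rightarrow> nat \<Rightarrow> bool" where
  "dominates P \<theta> r i k j \<longleftrightarrow>
     cost P \<theta> r i k \<le> cost P \<theta> r i j \<and> v_opt P i k \<ge> v_opt P i j \<and>
     (cost P \<theta> r i k < cost P \<theta> r i j \<or> v_opt P i k > v_opt P i j)"

text \<open>\<open>R i\<close> is the set of options of item \<open>i\<close> that remain after some (not necessarily
  exhaustive) application of the integer-safe within-item dominance rule.\<close>

definition integer_safe ::
  "pricing \<Rightarrow> real \<Rightarrow> (nat \<Rightarrow> nat) \<Rightarrow> (nat \<Rightarrow> nat set) \<Rightarrow> bool" where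
  "integer_safe P \<theta> r R \<longleftrightarrow>
     (\<forall>i\<in>items P. R i \<subseteq> adm_opts P i \<and>
        (\<forall>j\<in>adm_opts P i - R i. \<exists>k\<in>adm_opts P i. dominates P \<theta> r i k j))"

text \<open>A node is a partial selection; the set of its fixed items is its domain.\<close>

type_synonym node = "nat \<Rightarrow> nat option"

definition free_items :: "pricing \<Rightarrow> node \<Rightarrow> nat set" where
  "free_items P nd = items P - dom nd"

definition node_cost :: "pricing \<Rightarrow> real \<Rightarrow> (nat \<Rightarrow> nat) \<Rightarrow> node \<Rightarrow> real" where
  "node_cost P \<theta> r nd = (\<Sum>i\<in>dom nd. cost P \<theta> r i (the (nd i)))"

definition node_value :: "pricing \<Rightarrow> node \<Rightarrow> real" where
  "node_value P nd = (\<Sum>i\<in>dom nd. v_opt P i (the (nd i)))"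

definition completions :: "pricing \<Rightarrow> real \<Rightarrow> (nat \<Rightarrow> nat) \<Rightarrow> node \<Rightarrow> (nat \<Rightarrow> nat) set" where
  "completions P \<theta> r nd = {h \<in> mckp_feasible P \<theta> r. \<forall>i\<in>dom nd. nd i = Some (h i)}"

definition lp_points :: "pricing \<Rightarrow> real \<Rightarrow> (nat \<Rightarrow> nat) \<Rightarrow> node \<Rightarrow> (nat \<Rightarrow> nat \<Rightarrow> real) set" where
  "lp_points P \<theta> r nd =
     {y. (\<forall>i\<in>free_items P nd. (\<forall>j\<in>adm_opts P i. 0 \<le> y i j) \<and> (\<Sum>j\<in>adm_opts P i. y i j) = 1) \<and>
         (\<Sum>i\<in>free_items P nd. \<Sum>j\<in>adm_opts P i. cost P \<theta> r i j * y i j)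
           \<le> capacity P \<theta> r - node_cost P \<theta> r nd}"

definition lp_bound :: "pricing \<Rightarrow> real \<Rightarrow> (nat \<Rightarrow> nat) \<Rightarrow> node \<Rightarrow> ereal" where
  "lp_bound P \<theta> r nd = ereal (node_value P nd) +
     (SUP y\<in>lp_points P \<theta> r nd.
        ereal (\<Sum>i\<in>free_items P nd. \<Sum>j\<in>adm_opts P i. v_opt P i j * y i j))"

text \<open>State of one search: the feasible complete selections found so far (the incumbent is the
  best of them), the nodes pruned, the completely fixed nodes evaluated, and, for each node
  branched on, the branching item.\<close>

record search_state =
  found_sels :: "(nat \<Rightarrow> nat) set"
  pruned_nodes :: "node set"
  evaluated_nodes :: "node set"
  branch_item :: "node \<Rightarrow> nat option"

definition initial_search :: search_state where
  "initial_search = \<lparr>found_sels = {}, pruned_nodes = {}, evaluated_nodes = {},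
     branch_item = Map.empty\<rparr>"

definition incumbent_value :: "pricing \<Rightarrow> search_state \<Rightarrow> ereal" where
  "incumbent_value P s = (SUP h\<in>found_sels s. ereal (sel_value P h))"

inductive generated :: "(nat \<Rightarrow> nat set) \<Rightarrow> search_state \<Rightarrow> node \<Rightarrow> bool"
  for R :: "nat \<Rightarrow> nat set" and s :: search_state where
  root: "generated R s Map.empty"
| child: "\<lbrakk>generated R s nd; branch_item s nd = Some i; j \<in> R i\<rbrakk> \<Longrightarrow> generated R s (nd(i \<mapsto> j))"

inductive fathomed :: "(nat \<Rightarrow> nat set) \<Rightarrow> search_state \<Rightarrow> node \<Rightarrow> bool"
  for R :: "nat \<Rightarrow> nat set" and s :: search_state where
  pruned: "nd \<in> pruned_nodes s \<Longrightarrow> fathomed R s nd"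
| evaluated: "nd \<in> evaluated_nodes s \<Longrightarrow> fathomed R s nd"
| branched: "\<lbrakk>branch_item s nd = Some i; \<And>j. j \<in> R i \<Longrightarrow> fathomed R s (nd(i \<mapsto> j))\<rbrakk>
    \<Longrightarrow> fathomed R s nd"

definition live :: "(nat \<Rightarrow> nat set) \<Rightarrow> search_state \<Rightarrow> node \<Rightarrow> bool" where
  "live R s nd \<longleftrightarrow> generated R s nd \<and> nd \<notin> pruned_nodes s \<and> nd \<notin> evaluated_nodes s \<and>
     branch_item s nd = None"

definition node_selection :: "pricing \<Rightarrow> node \<Rightarrow> nat \<Rightarrow> nat" where
  "node_selection P nd = (\<lambda>i\<in>items P. the (nd i))"

text \<open>The last rule admits feasible selections from other sources, e.g. rounding or warm starts.\<close>

inductive search_step ::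
  "pricing \<Rightarrow> real \<Rightarrow> (nat \<Rightarrow> nat) \<Rightarrow> (nat \<Rightarrow> nat set) \<Rightarrow> search_state \<Rightarrow> search_state \<Rightarrow> bool"
  for P :: pricing and \<theta> :: real and r :: "nat \<Rightarrow> nat" and R :: "nat \<Rightarrow> nat set" where
  evaluate: "\<lbrakk>live R s nd; dom nd = items P\<rbrakk> \<Longrightarrow>
    search_step P \<theta> r R s
      (s\<lparr>evaluated_nodes := insert nd (evaluated_nodes s),
         found_sels := found_sels s \<union> ({node_selection P nd} \<inter> mckp_feasible P \<theta> r)\<rparr>)"
| prune: "\<lbrakk>live R s nd; completions P \<theta> r nd = {} \<or> lp_bound P \<theta> r nd \<le> incumbent_value P s\<rbrakk> \<Longrightarrow>
    search_step P \<theta> r R s (s\<lparr>pruned_nodes := insert nd (pruned_nodes s)\<rparr>)"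
| branch: "\<lbrakk>live R s nd; i \<in> free_items P nd\<rbrakk> \<Longrightarrow>
    search_step P \<theta> r R s (s\<lparr>branch_item := (branch_item s)(nd \<mapsto> i)\<rparr>)"
| discover: "h \<in> mckp_feasible P \<theta> r \<Longrightarrow>
    search_step P \<theta> r R s (s\<lparr>found_sels := insert h (found_sels s)\<rparr>)"

definition search_completed :: "(nat \<Rightarrow> nat set) \<Rightarrow> search_state \<Rightarrow> bool" where
  "search_completed R s \<longleftrightarrow> (\<forall>nd. generated R s nd \<longrightarrow> fathomed R s nd)"


section \<open>The global algorithm\<close>

record alg_state =
  found :: "(nat \<Rightarrow> real) set"
  searches :: "real \<Rightarrow> search_state"
  upper :: "real \<Rightarrow> ereal option"
  pruned_thresholds :: "real set"

definition initial_state :: alg_state where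
  "initial_state = \<lparr>found = {}, searches = (\<lambda>_. initial_search), upper = Map.empty,
     pruned_thresholds = {}\<rparr>"

definition sel_prices :: "pricing \<Rightarrow> (nat \<Rightarrow> nat) \<Rightarrow> nat \<Rightarrow> real" where
  "sel_prices P h = (\<lambda>i\<in>items P. price P i (h i))"

definition certified_incumbents :: "pricing \<Rightarrow> alg_state \<Rightarrow> (nat \<Rightarrow> real) set" where
  "certified_incumbents P S = {x \<in> found S. x \<in> price_vectors P \<and> robust_certificate P x}"

definition best_incumbent :: "pricing \<Rightarrow> alg_state \<Rightarrow> (nat \<Rightarrow> real) \<Rightarrow> bool" where
  "best_incumbent P S x \<longleftrightarrow> is_arg_max (revenue P) (\<lambda>x. x \<in> certified_incumbents P S) x"

definition Z_inc :: "pricing \<Rightarrow> alg_state \<Rightarrow> ereal" where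
  "Z_inc P S = (SUP x\<in>certified_incumbents P S. ereal (revenue P x))"

definition valid_bound :: "pricing \<Rightarrow> real \<Rightarrow> (nat \<Rightarrow> nat) \<Rightarrow> ereal \<Rightarrow> bool" where
  "valid_bound P \<theta> r u \<longleftrightarrow> u < \<infinity> \<and> Z_IP P \<theta> r \<le> u"

definition has_valid_bound ::
  "pricing \<Rightarrow> (real \<Rightarrow> nat \<Rightarrow> nat) \<Rightarrow> alg_state \<Rightarrow> real \<Rightarrow> bool" where
  "has_valid_bound P r S \<theta> \<longleftrightarrow> (\<exists>u. upper S \<theta> = Some u \<and> valid_bound P \<theta> (r \<theta>) u)"

text \<open>The step \<open>note_bound\<close> does not restrict the value recorded, so it covers every way of obtaining
  bounds (\<open>-\<infinity>\<close> for infeasible thresholds, root LP values, proven optima, best remaining node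
  bounds, \<dots>); whether a record may be relied upon is decided by \<^const>\<open>valid_bound\<close>. Likewise
  \<open>discover\<close> covers price vectors from any source; \<^const>\<open>certified_incumbents\<close> filters them.\<close>

inductive alg_step ::
  "pricing \<Rightarrow> (real \<Rightarrow> nat \<Rightarrow> nat) \<Rightarrow> (real \<Rightarrow> nat \<Rightarrow> nat set) \<Rightarrow> alg_state \<Rightarrow> alg_state \<Rightarrow> bool"
  for P :: pricing and r :: "real \<Rightarrow> nat \<Rightarrow> nat" and R :: "real \<Rightarrow> nat \<Rightarrow> nat set" where
  explore: "\<lbrakk>\<theta> \<in> thresholds P; \<theta> \<notin> pruned_thresholds S;
      search_step P \<theta> (r \<theta>) (R \<theta>) (searches S \<theta>) s'\<rbrakk> \<Longrightarrow>
    alg_step P r R S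
      (S\<lparr>searches := (searches S)(\<theta> := s'), found := found S \<union> sel_prices P ` found_sels s'\<rparr>)"
| discover: "alg_step P r R S (S\<lparr>found := insert x (found S)\<rparr>)"
| note_bound: "\<theta> \<in> thresholds P \<Longrightarrow> alg_step P r R S (S\<lparr>upper := (upper S)(\<theta> \<mapsto> u)\<rparr>)"
| prune: "\<lbrakk>\<theta> \<in> thresholds P; upper S \<theta> = Some u; valid_bound P \<theta> (r \<theta>) u; u \<le> Z_inc P S\<rbrakk> \<Longrightarrow>
    alg_step P r R S (S\<lparr>pruned_thresholds := insert \<theta> (pruned_thresholds S)\<rparr>)"

definition U_eff :: "pricing \<Rightarrow> (real \<Rightarrow> nat \<Rightarrow> nat) \<Rightarrow> alg_state \<Rightarrow> real \<Rightarrow> ereal" where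
  "U_eff P r S \<theta> = (if has_valid_bound P r S \<theta> then the (upper S \<theta>) else \<infinity>)"

definition U_global :: "pricing \<Rightarrow> (real \<Rightarrow> nat \<Rightarrow> nat) \<Rightarrow> alg_state \<Rightarrow> ereal" where
  "U_global P r S = (MAX \<theta>\<in>thresholds P. U_eff P r S \<theta>)"

end

theory Submission
  imports Defs "HOL-Library.Multiset"
begin

text \<open>
  The protection term is a minimum over thresholds: for every \<open>\<theta> \<ge> 0\<close>, the \<open>\<Gamma>\<close> largest of the numbers
  \<open>\<bar>t\<^sub>i\<bar>\<close> add up to at most \<open>\<Gamma>\<theta> + \<Sum>\<^sub>i max 0 (\<bar>t\<^sub>i\<bar> - \<theta>)\<close>, because each of them is at most
  \<open>\<theta> + max 0 (\<bar>t\<^sub>i\<bar> - \<theta>)\<close>, with equality when \<open>\<theta>\<close> separates the \<open>\<Gamma>\<close> largest values from the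
  others (\<open>protection_le\<close>, \<open>protection_attained\<close>). The separating value can be chosen among \<open>0\<close> and the
  \<open>\<bar>t\<^sub>i\<bar>\<close>, hence in \<open>\<B>\<close>. The capacity constraint of the fixed-\<open>\<theta>\<close> knapsack problem says that the
  robust certificate holds with this upper estimate in place of the protection term. So every selection
  feasible for some \<open>\<theta>\<close> is robustly feasible, and every robustly feasible price vector is feasible for
  some \<open>\<theta> \<in> \<B>\<close>: the robust optimum is the largest \<open>Z\<^sup>I\<^sup>P(\<theta>)\<close> over \<open>\<theta> \<in> \<B>\<close>. Part (b)
  follows, since \<open>Z\<^sup>I\<^sup>P(\<theta>) \<le> U\<^sub>\<theta>\<close> whenever the record is valid; part (c) holds because a missing
  record enters the maximum as \<open>\<infinity>\<close>.

  For part (a) it remains to see that \<open>Z\<^sup>I\<^sup>P(\<theta>) \<le> Z\<^sup>i\<^sup>n\<^sup>c\<close> for every \<open>\<theta> \<in> \<B>\<close>. If \<open>\<theta>\<close> is pruned, this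
  was witnessed by its record when it was pruned, and \<open>Z\<^sup>i\<^sup>n\<^sup>c\<close> only grows. If its search is completed,
  replace each option of a feasible selection by a remaining one that costs no more and is worth no
  less (\<open>dominance_reduction\<close>). Follow the resulting selection down the tree; the path ends in
  an evaluated node, which is the selection itself, or in a pruned node. The latter is not infeasible,
  as the selection completes it, so its linear bound, which is at least the value of the selection,
  did not exceed the incumbent value (\<open>fathomed_bound\<close>). Either way the incumbent of the search, and with
  it the global one, is at least as good.
\<close>

section \<open>The protection term as a minimum over thresholds\<close>

lemma sum_take_le_threshold:
  fixes ys :: "real list"
  assumes "0 \<le> \<theta>"
  shows "sum_list (take k ys) \<le> real k * \<theta> + (\<Sum>y\<leftarrow>ys. max 0 (y - \<theta>))"
proof (induction ys arbitrary: k)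
  case Nil
  then show ?case using assms by simp
next
  case (Cons y ys)
  show ?case
  proof (cases k)
    case 0
    have "0 \<le> (\<Sum>y\<leftarrow>ys. max 0 (y - \<theta>))" by (rule sum_list_nonneg) auto
    then show ?thesis using 0 by simp
  next
    case (Suc k')
    then show ?thesis using Cons.IH[of k'] by (simp add: algebra_simps)
  qed
qed

text \<open>A descending list is cut after its first \<open>k\<close> entries by its \<open>k\<close>-th entry. For \<open>k = 0\<close> there
  is no such entry, and any upper bound of the list will do: its first entry, or \<open>0\<close> if it is empty.\<close>

lemma descending_list_separator:
  fixes ys :: "real list"
  assumes desc: "sorted_wrt (\<ge>) ys" and k: "k \<le> length ys"
  shows "\<exists>\<theta>\<in>insert 0 (set ys). (\<forall>y\<in>set (take k ys). \<theta> \<le> y) \<and> (\<forall>y\<in>set (drop k ys). y \<le> \<theta>)"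
proof (cases "ys = []")
  case True
  then show ?thesis by simp
next
  case False
  define m where "m = k - 1"
  have m: "m < length ys" using False k by (cases k) (auto simp: m_def)
  have mono: "ys ! j \<le> ys ! i" if "i \<le> j" "j < length ys" for i j
    using that desc by (cases "i = j") (auto simp: sorted_wrt_iff_nth_less)
  have "ys ! m \<le> y" if "y \<in> set (take k ys)" for y
  proof -
    from that obtain i where "i < length (take k ys)" "y = take k ys ! i"
      by (metis in_set_conv_nth)
    then show ?thesis using m by (auto simp: m_def intro!: mono)
  qed
  moreover have "y \<le> ys ! m" if "y \<in> set (drop k ys)" for y
  proof -
    from that obtain i where "i < length (drop k ys)" "y = drop k ys ! i"
      by (metis in_set_conv_nth)
    then show ?thesis by (auto simp: m_def intro!: mono)
  qed
  ultimately show ?thesis using m by (intro bexI[of _ "ys ! m"]) auto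
qed

lemma sum_take_eq_threshold:
  fixes ys :: "real list"
  assumes k: "k \<le> length ys"
    and lower: "\<And>y. y \<in> set (take k ys) \<Longrightarrow> \<theta> \<le> y"
    and upper: "\<And>y. y \<in> set (drop k ys) \<Longrightarrow> y \<le> \<theta>"
  shows "sum_list (take k ys) = real k * \<theta> + (\<Sum>y\<leftarrow>ys. max 0 (y - \<theta>))"
proof -
  have "(\<Sum>y\<leftarrow>ys. max 0 (y - \<theta>))
      = (\<Sum>y\<leftarrow>take k ys. max 0 (y - \<theta>)) + (\<Sum>y\<leftarrow>drop k ys. max 0 (y - \<theta>))"
    by (metis append_take_drop_id map_append sum_list_append)
  also have "(\<Sum>y\<leftarrow>take k ys. max 0 (y - \<theta>)) = (\<Sum>y\<leftarrow>take k ys. y - \<theta>)"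
    by (intro arg_cong[where f = sum_list] map_cong refl) (use lower in force)
  also have "\<dots> = sum_list (take k ys) - real k * \<theta>"
    using k by (simp add: sum_list_subtractf sum_list_triv)
  also have "(\<Sum>y\<leftarrow>drop k ys. max 0 (y - \<theta>)) = (\<Sum>y\<leftarrow>drop k ys. 0)"
    by (intro arg_cong[where f = sum_list] map_cong refl) (use upper in force)
  finally show ?thesis by simp
qed

definition deviations_desc :: "pricing \<Rightarrow> (nat \<Rightarrow> real) \<Rightarrow> real list" where
  "deviations_desc P x = rev (sort (map (\<lambda>i. \<bar>t_of P i (x i)\<bar>) [1..<Suc (num_items P)]))"

definition threshold_protection :: "pricing \<Rightarrow> real \<Rightarrow> (nat \<Rightarrow> real) \<Rightarrow> real" where
  "threshold_protection P \<theta> x =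
     real (budget P) * \<theta> + (\<Sum>i\<in>items P. max 0 (\<bar>t_of P i (x i)\<bar> - \<theta>))"

lemma protection_deviations_desc:
  "protection P x = sum_list (take (budget P) (deviations_desc P x))"
  by (simp only: protection_def deviations_desc_def)

lemma threshold_protection_deviations_desc:
  "threshold_protection P \<theta> x =
     real (budget P) * \<theta> + (\<Sum>y\<leftarrow>deviations_desc P x. max 0 (y - \<theta>))"
proof -
  let ?ts = "map (\<lambda>i. \<bar>t_of P i (x i)\<bar>) [1..<Suc (num_items P)]"
  have "mset (map (\<lambda>y. max 0 (y - \<theta>)) (deviations_desc P x)) = mset (map (\<lambda>y. max 0 (y - \<theta>)) ?ts)"
    by (simp only: deviations_desc_def mset_map mset_rev mset_sort)
  then have "(\<Sum>y\<leftarrow>deviations_desc P x. max 0 (y - \<theta>)) = (\<Sum>y\<leftarrow>?ts. max 0 (y - \<theta>))"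
    by (metis sum_mset_sum_list)
  also have "\<dots> = (\<Sum>i\<leftarrow>[1..<Suc (num_items P)]. max 0 (\<bar>t_of P i (x i)\<bar> - \<theta>))"
    by (simp only: map_map o_def)
  also have "\<dots> = (\<Sum>i\<in>set [1..<Suc (num_items P)]. max 0 (\<bar>t_of P i (x i)\<bar> - \<theta>))"
    by (rule sum_list_distinct_conv_sum_set) (rule distinct_upt)
  also have "set [1..<Suc (num_items P)] = items P"
    by (simp only: items_def set_upt atLeastLessThanSuc_atLeastAtMost)
  finally show ?thesis by (simp add: threshold_protection_def)
qed

lemma protection_le:
  assumes "0 \<le> \<theta>"
  shows "protection P x \<le> threshold_protection P \<theta> x"
  unfolding protection_deviations_desc threshold_protection_deviations_desc
  by (rule sum_take_le_threshold[OF assms])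

lemma protection_attained:
  assumes "budget P \<le> num_items P"
  shows "\<exists>\<theta>\<in>insert 0 ((\<lambda>i. \<bar>t_of P i (x i)\<bar>) ` items P).
    protection P x = threshold_protection P \<theta> x"
proof -
  let ?ys = "deviations_desc P x"
  have len: "budget P \<le> length ?ys" using assms by (simp add: deviations_desc_def del: upt_Suc)
  have desc: "sorted_wrt (\<ge>) ?ys"
    unfolding deviations_desc_def sorted_wrt_rev by (rule sorted_sort)
  have set: "set ?ys = (\<lambda>i. \<bar>t_of P i (x i)\<bar>) ` items P"
    by (simp add: deviations_desc_def items_def atLeastLessThanSuc_atLeastAtMost del: upt_Suc)
  obtain \<theta> where \<theta>: "\<theta> \<in> insert 0 (set ?ys)"
      "\<And>y. y \<in> set (take (budget P) ?ys) \<Longrightarrow> \<theta> \<le> y"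
      "\<And>y. y \<in> set (drop (budget P) ?ys) \<Longrightarrow> y \<le> \<theta>"
    using descending_list_separator[OF desc len] by blast
  from sum_take_eq_threshold[OF len \<theta>(2,3)] have "protection P x = threshold_protection P \<theta> x"
    unfolding protection_deviations_desc threshold_protection_deviations_desc by simp
  then show ?thesis using \<theta>(1) unfolding set by blast
qed


section \<open>Finiteness of the data\<close>

lemma finite_items: "finite (items P)"
  by (simp add: items_def)

lemma finite_adm_opts: "finite (adm_opts P i)"
  by (simp add: adm_opts_def)

lemma finite_thresholds: "finite (thresholds P)"
proof -
  have "{\<bar>t_opt P i j\<bar> | i j. i \<in> items P \<and> j \<in> adm_opts P i}
      = (\<lambda>(i, j). \<bar>t_opt P i j\<bar>) ` Sigma (items P) (adm_opts P)" by auto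
  then show ?thesis unfolding thresholds_def
    by (simp only:) (simp add: finite_items finite_adm_opts)
qed

lemma thresholds_nonneg: "\<theta> \<in> thresholds P \<Longrightarrow> 0 \<le> \<theta>"
  by (auto simp: thresholds_def)

lemma finite_robust_feasible: "finite (robust_feasible P)"
proof -
  have "finite (price_vectors P)" unfolding price_vectors_def
    by (intro finite_PiE finite_items) (simp add: adm_menu_def menu_def)
  then show ?thesis unfolding robust_feasible_def by simp
qed


section \<open>Robust feasibility and the fixed-threshold problems\<close>

text \<open>The reference options cancel: the sum of the \<open>s\<^sup>\<theta>\<close> over them occurs both in the cost and in the
  capacity.\<close>

lemma mckp_feasible_iff:
  "h \<in> mckp_feasible P \<theta> r \<longleftrightarrow> h \<in> selections P \<and>
     threshold_protection P \<theta> (sel_prices P h) \<le> (\<Sum>i\<in>items P. s_of P i (sel_prices P h i))"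
  by (simp add: mckp_feasible_def cost_def capacity_def s_theta_def s_opt_def t_opt_def
      sum_subtractf threshold_protection_def sel_prices_def) linarith

lemma revenue_sel_prices: "revenue P (sel_prices P h) = sel_value P h"
  by (simp add: revenue_def sel_value_def sel_prices_def v_opt_def)

lemma sel_prices_robust_feasible:
  assumes "0 \<le> \<theta>" and h: "h \<in> mckp_feasible P \<theta> r"
  shows "sel_prices P h \<in> robust_feasible P"
proof -
  have "sel_prices P h \<in> price_vectors P"
    using h by (auto simp: mckp_feasible_iff selections_def sel_prices_def price_vectors_def
        adm_opts_def PiE_iff)
  moreover have "robust_certificate P (sel_prices P h)"
    using h protection_le[OF assms(1), of P "sel_prices P h"]
    by (simp add: mckp_feasible_iff robust_certificate_def)
  ultimately show ?thesis by (simp add: robust_feasible_def)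
qed

lemma robust_feasible_mckp_feasible:
  assumes "budget P \<le> num_items P" and x: "x \<in> robust_feasible P"
  shows "\<exists>\<theta>\<in>thresholds P. \<exists>h. sel_prices P h = x \<and> (\<forall>r. h \<in> mckp_feasible P \<theta> r)"
proof -
  have xpv: "x \<in> price_vectors P" and cert: "robust_certificate P x"
    using x by (auto simp: robust_feasible_def)
  have "\<exists>j\<in>adm_opts P i. price P i j = x i" if "i \<in> items P" for i
  proof -
    have "x i \<in> adm_menu P i" using xpv that by (auto simp: price_vectors_def)
    then show ?thesis by (auto simp: adm_opts_def adm_menu_def menu_def)
  qed
  then obtain g where g: "\<And>i. i \<in> items P \<Longrightarrow> g i \<in> adm_opts P i \<and> price P i (g i) = x i"
    by metis
  define h where "h = restrict g (items P)"
  have hsel: "h \<in> selections P" using g by (auto simp: h_def selections_def)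
  have hx: "sel_prices P h = x"
    using g xpv by (auto simp: sel_prices_def h_def price_vectors_def PiE_iff extensional_def fun_eq_iff)
  obtain \<theta> where \<theta>: "\<theta> \<in> insert 0 ((\<lambda>i. \<bar>t_of P i (x i)\<bar>) ` items P)"
      and eq: "protection P x = threshold_protection P \<theta> x"
    using protection_attained[OF assms(1)] by blast
  have "\<theta> \<in> thresholds P"
  proof (cases "\<theta> = 0")
    case False
    then obtain i where i: "i \<in> items P" "\<theta> = \<bar>t_of P i (x i)\<bar>" using \<theta> by auto
    then have "\<theta> = \<bar>t_opt P i (g i)\<bar>" using g by (simp add: t_opt_def)
    then show ?thesis using g i(1) by (auto simp: thresholds_def)
  qed (simp add: thresholds_def)
  moreover have "h \<in> mckp_feasible P \<theta> r" for r
    using hsel cert eq by (simp add: mckp_feasible_iff hx robust_certificate_def)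
  ultimately show ?thesis using hx by blast
qed

lemma revenue_le_Z_IP:
  assumes "budget P \<le> num_items P" and "x \<in> robust_feasible P"
  shows "\<exists>\<theta>\<in>thresholds P. ereal (revenue P x) \<le> Z_IP P \<theta> (r \<theta>)"
proof -
  obtain \<theta> h where "\<theta> \<in> thresholds P" "sel_prices P h = x" "h \<in> mckp_feasible P \<theta> (r \<theta>)"
    using robust_feasible_mckp_feasible[OF assms] by blast
  then show ?thesis unfolding Z_IP_def
    by (metis SUP_upper revenue_sel_prices)
qed

lemma certified_incumbents_eq: "certified_incumbents P S = found S \<inter> robust_feasible P"
  by (auto simp: certified_incumbents_def robust_feasible_def)

lemma Z_inc_le_Z_rob: "Z_inc P S \<le> Z_rob P"
  unfolding Z_inc_def Z_rob_def certified_incumbents_eq by (rule SUP_subset_mono) auto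

lemma Z_rob_less_infinity: "Z_rob P < \<infinity>"
proof (cases "robust_feasible P = {}")
  case True
  then show ?thesis by (simp add: Z_rob_def bot_ereal_def)
next
  case False
  then obtain x where "x \<in> robust_feasible P" by blast
  then show ?thesis unfolding Z_rob_def
    by (intro finite_imp_Sup_less[where x = "ereal (revenue P x)"])
      (auto simp: finite_robust_feasible)
qed


section \<open>Dominance and linear bounds\<close>

text \<open>A dominating option may itself have been removed. Among the finitely many options that are no worse
  than \<open>j\<close>, one maximizing value minus cost cannot be dominated, so it remains.\<close>

lemma remaining_option_no_worse:
  assumes safe: "integer_safe P \<theta> r R" and i: "i \<in> items P" and j: "j \<in> adm_opts P i"
  shows "\<exists>k\<in>R i. cost P \<theta> r i k \<le> cost P \<theta> r i j \<and> v_opt P i j \<le> v_opt P i k"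
proof -
  define K where "K = {k \<in> adm_opts P i. cost P \<theta> r i k \<le> cost P \<theta> r i j \<and> v_opt P i j \<le> v_opt P i k}"
  define gain where "gain k = v_opt P i k - cost P \<theta> r i k" for k
  have "finite K" "K \<noteq> {}" using j by (auto simp: K_def finite_adm_opts)
  then obtain k where k: "k \<in> K" and max: "\<And>k'. k' \<in> K \<Longrightarrow> gain k' \<le> gain k"
    using Max_in[of "gain ` K"] Max_ge[of "gain ` K"] by fastforce
  have "k \<in> R i"
  proof (rule ccontr)
    assume "k \<notin> R i"
    then obtain k' where k': "k' \<in> adm_opts P i" and dom: "dominates P \<theta> r i k' k"
      using safe i k unfolding integer_safe_def K_def by blast
    have "k' \<in> K" using k k' dom by (auto simp: K_def dominates_def)
    moreover have "gain k < gain k'" using dom by (auto simp: gain_def dominates_def)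
    ultimately show False using max by force
  qed
  then show ?thesis using k by (auto simp: K_def)
qed

lemma dominance_reduction:
  assumes safe: "integer_safe P \<theta> r R" and h: "h \<in> mckp_feasible P \<theta> r"
  shows "\<exists>h'\<in>mckp_feasible P \<theta> r. (\<forall>i\<in>items P. h' i \<in> R i) \<and> sel_value P h \<le> sel_value P h'"
proof -
  have "\<forall>i\<in>items P. \<exists>k\<in>R i. cost P \<theta> r i k \<le> cost P \<theta> r i (h i) \<and> v_opt P i (h i) \<le> v_opt P i k"
    using h remaining_option_no_worse[OF safe] by (auto simp: mckp_feasible_def selections_def)
  then obtain g where g: "\<And>i. i \<in> items P \<Longrightarrow> g i \<in> R i \<and>
      cost P \<theta> r i (g i) \<le> cost P \<theta> r i (h i) \<and> v_opt P i (h i) \<le> v_opt P i (g i)"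
    by metis
  define h' where "h' = restrict g (items P)"
  have "h' \<in> selections P"
    using g safe by (auto simp: h'_def selections_def integer_safe_def)
  moreover have "(\<Sum>i\<in>items P. cost P \<theta> r i (h' i)) \<le> (\<Sum>i\<in>items P. cost P \<theta> r i (h i))"
    using g by (intro sum_mono) (simp add: h'_def)
  ultimately have "h' \<in> mckp_feasible P \<theta> r" using h by (auto simp: mckp_feasible_def)
  moreover have "sel_value P h \<le> sel_value P h'" unfolding sel_value_def
    using g by (intro sum_mono) (simp add: h'_def)
  moreover have "\<forall>i\<in>items P. h' i \<in> R i" using g by (simp add: h'_def)
  ultimately show ?thesis by blast
qed

text \<open>The indicator vector of the completion is a point of the relaxation.\<close>

lemma completion_le_lp_bound:
  assumes dom: "dom nd \<subseteq> items P" and h: "h \<in> completions P \<theta> r nd"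
  shows "ereal (sel_value P h) \<le> lp_bound P \<theta> r nd"
proof -
  define y :: "nat \<Rightarrow> nat \<Rightarrow> real" where "y i j = (if j = h i then 1 else 0)" for i j
  have hf: "h \<in> mckp_feasible P \<theta> r" and agree: "\<And>i. i \<in> dom nd \<Longrightarrow> nd i = Some (h i)"
    using h by (auto simp: completions_def)
  have opt: "h i \<in> adm_opts P i" if "i \<in> free_items P nd" for i
    using that hf by (auto simp: mckp_feasible_def selections_def free_items_def)
  have pick: "(\<Sum>j\<in>adm_opts P i. f j * y i j) = f (h i)" if "i \<in> free_items P nd"
    for f :: "nat \<Rightarrow> real" and i
    using opt[OF that] finite_adm_opts[of P i] by (simp add: y_def if_distrib sum.delta cong: if_cong)
  have split: "(\<Sum>i\<in>items P. f i) = (\<Sum>i\<in>dom nd. f i) + (\<Sum>i\<in>free_items P nd. f i)"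
    for f :: "nat \<Rightarrow> real"
    using sum.subset_diff[OF dom finite_items, of f] by (simp add: free_items_def)
  have cost: "node_cost P \<theta> r nd = (\<Sum>i\<in>dom nd. cost P \<theta> r i (h i))"
    unfolding node_cost_def using agree by (intro sum.cong) auto
  have val: "node_value P nd = (\<Sum>i\<in>dom nd. v_opt P i (h i))"
    unfolding node_value_def using agree by (intro sum.cong) auto
  have "(\<Sum>j\<in>adm_opts P i. y i j) = 1" if "i \<in> free_items P nd" for i
    using pick[OF that, of "\<lambda>_. 1"] by simp
  moreover have "0 \<le> y i j" for i j by (simp add: y_def)
  ultimately have "y \<in> lp_points P \<theta> r nd"
    using hf split[of "\<lambda>i. cost P \<theta> r i (h i)"]
    by (simp add: lp_points_def pick cost mckp_feasible_def)
  then have "ereal (\<Sum>i\<in>free_items P nd. \<Sum>j\<in>adm_opts P i. v_opt P i j * y i j)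
      \<le> (SUP y\<in>lp_points P \<theta> r nd.
          ereal (\<Sum>i\<in>free_items P nd. \<Sum>j\<in>adm_opts P i. v_opt P i j * y i j))"
    by (rule SUP_upper)
  then have "ereal (node_value P nd) + ereal (\<Sum>i\<in>free_items P nd. v_opt P i (h i)) \<le> lp_bound P \<theta> r nd"
    unfolding lp_bound_def by (intro add_left_mono) (simp add: pick)
  then show ?thesis
    using split[of "\<lambda>i. v_opt P i (h i)"] by (simp add: sel_value_def val)
qed


section \<open>Correctness of one branch-and-bound search\<close>

text \<open>What the rules of the search guarantee about its current state. Fathoming looks only at the
  bookkeeping of a state, so the reason for which a node was closed is recorded here, with
  the incumbent of the current state, which is at least the one against which the node was pruned.\<close>

definition search_invariant :: "pricing \<Rightarrow> real \<Rightarrow> (nat \<Rightarrow> nat) \<Rightarrow> search_state \<Rightarrow> bool" where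
  "search_invariant P \<theta> r s \<longleftrightarrow>
     found_sels s \<subseteq> mckp_feasible P \<theta> r \<and>
     (\<forall>nd i. branch_item s nd = Some i \<longrightarrow> i \<in> items P) \<and>
     (\<forall>nd\<in>pruned_nodes s. dom nd \<subseteq> items P \<and>
        (completions P \<theta> r nd = {} \<or> lp_bound P \<theta> r nd \<le> incumbent_value P s)) \<and>
     (\<forall>nd\<in>evaluated_nodes s. dom nd = items P \<and>
        (node_selection P nd \<in> mckp_feasible P \<theta> r \<longrightarrow> node_selection P nd \<in> found_sels s))"

lemma search_invariant_initial: "search_invariant P \<theta> r initial_search"
  by (simp add: search_invariant_def initial_search_def)

lemma generated_dom:
  assumes "generated R s nd" and "\<And>nd i. branch_item s nd = Some i \<Longrightarrow> i \<in> items P"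
  shows "dom nd \<subseteq> items P"
  using assms(1)
proof induction
  case (child nd i j)
  then show ?case using assms(2)[of nd i] by (auto simp: dom_def)
qed simp

lemma incumbent_value_mono:
  "found_sels s \<subseteq> found_sels s' \<Longrightarrow> incumbent_value P s \<le> incumbent_value P s'"
  unfolding incumbent_value_def by (rule SUP_subset_mono) auto

lemma search_invariant_step:
  assumes step: "search_step P \<theta> r R s s'" and inv: "search_invariant P \<theta> r s"
  shows "search_invariant P \<theta> r s'"
proof -
  have keep: "incumbent_value P s \<le> incumbent_value P s'"
    using step by cases (auto intro!: incumbent_value_mono)
  have old: "completions P \<theta> r nd = {} \<or> lp_bound P \<theta> r nd \<le> incumbent_value P s'"
    if "nd \<in> pruned_nodes s" for nd
    using inv that keep unfolding search_invariant_def by (meson order_trans)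
  from step show ?thesis
  proof cases
    case (evaluate nd)
    then show ?thesis using inv old by (auto simp: search_invariant_def)
  next
    case (prune nd)
    then have "dom nd \<subseteq> items P"
      using inv by (intro generated_dom[of R s]) (auto simp: live_def search_invariant_def)
    moreover have "completions P \<theta> r nd = {} \<or> lp_bound P \<theta> r nd \<le> incumbent_value P s'"
      using prune keep by (meson order_trans)
    ultimately show ?thesis using inv old prune(1) by (auto simp: search_invariant_def)
  next
    case (branch nd i)
    then show ?thesis using inv old by (auto simp: search_invariant_def free_items_def)
  next
    case (discover h)
    then show ?thesis using inv old by (auto simp: search_invariant_def)
  qed
qed

text \<open>Only selections of remaining options are followed: branching creates no child for an option that
  was removed, so another completion may have no descendant to which it belongs.\<close>

lemma fathomed_bound:
  assumes "fathomed R s nd" and inv: "search_invariant P \<theta> r s"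
    and "h \<in> completions P \<theta> r nd" and rem: "\<forall>i\<in>items P. h i \<in> R i"
  shows "ereal (sel_value P h) \<le> incumbent_value P s"
  using assms(1,3)
proof (induction nd rule: fathomed.induct)
  case (pruned nd)
  then have "ereal (sel_value P h) \<le> lp_bound P \<theta> r nd"
    using inv by (intro completion_le_lp_bound) (auto simp: search_invariant_def)
  also have "\<dots> \<le> incumbent_value P s"
    using pruned inv by (auto simp: search_invariant_def)
  finally show ?case .
next
  case (evaluated nd)
  then have dom: "dom nd = items P" using inv by (auto simp: search_invariant_def)
  have hf: "h \<in> mckp_feasible P \<theta> r" using evaluated by (auto simp: completions_def)
  have "node_selection P nd = h"
  proof
    fix i
    show "node_selection P nd i = h i"
      using evaluated(2) hf dom
      by (cases "i \<in> items P") (auto simp: node_selection_def completions_def mckp_feasible_def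
          selections_def PiE_iff extensional_def)
  qed
  then have "h \<in> found_sels s" using evaluated(1) inv hf by (auto simp: search_invariant_def)
  then show ?case unfolding incumbent_value_def by (rule SUP_upper)
next
  case (branched nd i)
  have "i \<in> items P" using branched(1) inv by (auto simp: search_invariant_def)
  then have "h i \<in> R i" using rem by blast
  moreover have "h \<in> completions P \<theta> r (nd(i \<mapsto> h i))"
    using branched.prems by (auto simp: completions_def)
  ultimately show ?case using branched.IH by blast
qed

lemma completed_search_optimal:
  assumes inv: "search_invariant P \<theta> r s" and safe: "integer_safe P \<theta> r R"
    and "search_completed R s"
  shows "Z_IP P \<theta> r \<le> incumbent_value P s"
  unfolding Z_IP_def
proof (rule SUP_least)
  fix h assume "h \<in> mckp_feasible P \<theta> r"
  then obtain h' where h': "h' \<in> mckp_feasible P \<theta> r" "\<forall>i\<in>items P. h' i \<in> R i"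
      "sel_value P h \<le> sel_value P h'"
    using dominance_reduction[OF safe] by blast
  have "fathomed R s Map.empty"
    using assms(3) generated.root by (auto simp: search_completed_def)
  moreover have "h' \<in> completions P \<theta> r Map.empty" using h'(1) by (simp add: completions_def)
  ultimately have "ereal (sel_value P h') \<le> incumbent_value P s"
    using fathomed_bound[OF _ inv] h'(2) by blast
  then show "ereal (sel_value P h) \<le> incumbent_value P s"
    using h'(3) by (meson ereal_less_eq(3) order_trans)
qed


section \<open>Correctness of the global algorithm\<close>

definition alg_invariant ::
  "pricing \<Rightarrow> (real \<Rightarrow> nat \<Rightarrow> nat) \<Rightarrow> alg_state \<Rightarrow> bool" where
  "alg_invariant P r S \<longleftrightarrow>
     (\<forall>\<theta>. search_invariant P \<theta> (r \<theta>) (searches S \<theta>) \<and>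
          sel_prices P ` found_sels (searches S \<theta>) \<subseteq> found S) \<and>
     (\<forall>\<theta>\<in>pruned_thresholds S. Z_IP P \<theta> (r \<theta>) \<le> Z_inc P S)"

lemma alg_invariant_step:
  assumes step: "alg_step P r R S S'" and inv: "alg_invariant P r S"
  shows "alg_invariant P r S'"
proof -
  have "found S \<subseteq> found S'" using step by cases auto
  then have "Z_inc P S \<le> Z_inc P S'"
    unfolding Z_inc_def certified_incumbents_eq by (intro SUP_subset_mono) auto
  then have old: "Z_IP P \<theta> (r \<theta>) \<le> Z_inc P S'" if "\<theta> \<in> pruned_thresholds S" for \<theta>
    using inv that unfolding alg_invariant_def by (meson order_trans)
  from step show ?thesis
  proof cases
    case (explore \<theta> s')
    have "search_invariant P \<theta> (r \<theta>) s'"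
      using search_invariant_step[OF explore(4)] inv by (auto simp: alg_invariant_def)
    then show ?thesis using inv old explore(1) by (auto simp: alg_invariant_def)
  next
    case (discover x)
    then show ?thesis using inv old by (auto simp: alg_invariant_def)
  next
    case (note_bound \<theta> u)
    then show ?thesis using inv old by (auto simp: alg_invariant_def)
  next
    case (prune \<theta> u)
    have "Z_IP P \<theta> (r \<theta>) \<le> Z_inc P S"
      using prune by (auto simp: valid_bound_def intro: order_trans)
    then have "Z_IP P \<theta> (r \<theta>) \<le> Z_inc P S'"
      using \<open>Z_inc P S \<le> Z_inc P S'\<close> by (rule order_trans)
    then show ?thesis using inv old prune(1) by (auto simp: alg_invariant_def)
  qed
qed

lemma alg_invariant_reachable:
  assumes "(alg_step P r R)\<^sup>*\<^sup>* initial_state S"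
  shows "alg_invariant P r S"
  using assms
proof induction
  case base
  show ?case
    by (simp add: alg_invariant_def initial_state_def search_invariant_initial)
      (simp add: initial_search_def)
next
  case (step S S')
  then show ?case using alg_invariant_step by blast
qed

text \<open>The selections found by a search pass the robust certificate, so they count as incumbents
  of the global algorithm.\<close>

lemma incumbent_value_le_Z_inc:
  assumes inv: "alg_invariant P r S" and "0 \<le> \<theta>"
  shows "incumbent_value P (searches S \<theta>) \<le> Z_inc P S"
  unfolding incumbent_value_def
proof (rule SUP_least)
  fix h assume h: "h \<in> found_sels (searches S \<theta>)"
  then have "h \<in> mckp_feasible P \<theta> (r \<theta>)" and "sel_prices P h \<in> found S"
    using inv by (fastforce simp: alg_invariant_def search_invariant_def)+
  then have "sel_prices P h \<in> certified_incumbents P S"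
    using sel_prices_robust_feasible[OF assms(2)] by (auto simp: certified_incumbents_eq)
  then show "ereal (sel_value P h) \<le> Z_inc P S"
    unfolding Z_inc_def revenue_sel_prices[symmetric] by (rule SUP_upper)
qed

lemma completed_algorithm_optimal:
  assumes budget: "budget P \<le> num_items P"
    and safe: "\<forall>\<theta>\<in>thresholds P. integer_safe P \<theta> (r \<theta>) (R \<theta>)"
    and reach: "(alg_step P r R)\<^sup>*\<^sup>* initial_state S"
    and compl: "\<forall>\<theta>\<in>thresholds P. \<theta> \<notin> pruned_thresholds S \<longrightarrow> search_completed (R \<theta>) (searches S \<theta>)"
  shows "Z_inc P S = Z_rob P"
proof (rule antisym[OF Z_inc_le_Z_rob])
  have inv: "alg_invariant P r S" by (rule alg_invariant_reachable[OF reach])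
  have IP: "Z_IP P \<theta> (r \<theta>) \<le> Z_inc P S" if \<theta>: "\<theta> \<in> thresholds P" for \<theta>
  proof (cases "\<theta> \<in> pruned_thresholds S")
    case True
    then show ?thesis using inv by (auto simp: alg_invariant_def)
  next
    case False
    then have "Z_IP P \<theta> (r \<theta>) \<le> incumbent_value P (searches S \<theta>)"
      using \<theta> safe compl inv by (intro completed_search_optimal) (auto simp: alg_invariant_def)
    also have "\<dots> \<le> Z_inc P S"
      by (rule incumbent_value_le_Z_inc[OF inv thresholds_nonneg[OF \<theta>]])
    finally show ?thesis .
  qed
  show "Z_rob P \<le> Z_inc P S" unfolding Z_rob_def
  proof (rule SUP_least)
    fix x assume "x \<in> robust_feasible P"
    then show "ereal (revenue P x) \<le> Z_inc P S"
      using revenue_le_Z_IP[OF budget, of x r] IP by (meson order_trans)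
  qed
qed

lemma best_incumbent_exists:
  assumes "Z_inc P S = Z_rob P" and "robust_feasible P \<noteq> {}"
  shows "\<exists>x. best_incumbent P S x"
proof -
  let ?C = "certified_incumbents P S"
  have "finite ?C" by (simp add: certified_incumbents_eq finite_robust_feasible)
  moreover have "?C \<noteq> {}"
  proof
    assume "?C = {}"
    then have "Z_rob P = -\<infinity>" using assms(1) by (simp add: Z_inc_def bot_ereal_def)
    then show False using assms(2) by (auto simp: Z_rob_def SUP_eq_iff SUP_bot_conv bot_ereal_def[symmetric])
        (simp add: bot_ereal_def)
  qed
  ultimately obtain x where "x \<in> ?C" "\<forall>y\<in>?C. revenue P y \<le> revenue P x"
    using Max_in[of "revenue P ` ?C"] Max_ge[of "revenue P ` ?C"] by fastforce
  then show ?thesis by (auto simp: best_incumbent_def is_arg_max_def not_less)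
qed

lemma best_incumbent_optimal:
  assumes "Z_inc P S = Z_rob P" and best: "best_incumbent P S x"
  shows "globally_optimal P x"
proof -
  have "ereal (revenue P y) \<le> ereal (revenue P x)" if "y \<in> robust_feasible P" for y
  proof -
    have "ereal (revenue P y) \<le> Z_inc P S"
      unfolding assms(1) Z_rob_def using that by (rule SUP_upper)
    also have "\<dots> \<le> ereal (revenue P x)"
      unfolding Z_inc_def using best
      by (intro SUP_least) (auto simp: best_incumbent_def is_arg_max_def not_less)
    finally show ?thesis .
  qed
  then show ?thesis using best
    by (auto simp: best_incumbent_def globally_optimal_def is_arg_max_def certified_incumbents_eq not_less)
qed

lemma U_eff_le_U_global: "\<theta> \<in> thresholds P \<Longrightarrow> U_eff P r S \<theta> \<le> U_global P r S"
  unfolding U_global_def by (rule Max_ge) (auto simp: finite_thresholds)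

lemma Z_rob_le_U_global:
  assumes "budget P \<le> num_items P"
  shows "Z_rob P \<le> U_global P r S"
  unfolding Z_rob_def
proof (rule SUP_least)
  fix x assume "x \<in> robust_feasible P"
  then obtain \<theta> where \<theta>: "\<theta> \<in> thresholds P" "ereal (revenue P x) \<le> Z_IP P \<theta> (r \<theta>)"
    using revenue_le_Z_IP[OF assms] by blast
  note \<theta>(2)
  also have "Z_IP P \<theta> (r \<theta>) \<le> U_eff P r S \<theta>"
    by (auto simp: U_eff_def has_valid_bound_def valid_bound_def)
  also have "\<dots> \<le> U_global P r S" by (rule U_eff_le_U_global[OF \<theta>(1)])
  finally show "ereal (revenue P x) \<le> U_global P r S" .
qed

text \<open>If there is no incumbent, then \<open>Z_inc P S = -\<infinity>\<close>, and the difference is \<open>\<infinity>\<close>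
  even when the minuend is \<open>-\<infinity>\<close>, because \<open>-\<infinity> + \<infinity> = \<infinity>\<close> for extended reals.\<close>

lemma gap_nonneg: "0 \<le> Z_rob P - Z_inc P S"
  using Z_inc_le_Z_rob[of P S] Z_rob_less_infinity[of P]
  by (cases "Z_rob P"; cases "Z_inc P S") auto

theorem theorem12:
  fixes P :: pricing
    and r :: "real \<Rightarrow> nat \<Rightarrow> nat"
    and R :: "real \<Rightarrow> nat \<Rightarrow> nat set"
    and S :: alg_state
  assumes "pricing_data P"
    and "\<forall>\<theta>\<in>thresholds P. reference_choice P \<theta> (r \<theta>)"
  shows
    "((\<forall>\<theta>\<in>thresholds P. integer_safe P \<theta> (r \<theta>) (R \<theta>)) \<longrightarrow>
      (alg_step P r R)\<^sup>*\<^sup>* initial_state S \<longrightarrow>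
      (\<forall>\<theta>\<in>thresholds P. \<theta> \<notin> pruned_thresholds S \<longrightarrow> search_completed (R \<theta>) (searches S \<theta>)) \<longrightarrow>
        Z_inc P S = Z_rob P \<and>
        (robust_feasible P \<noteq> {} \<longrightarrow> (\<exists>x. best_incumbent P S x)) \<and>
        (\<forall>x. best_incumbent P S x \<longrightarrow> globally_optimal P x))
     \<and>
     ((\<forall>\<theta>\<in>thresholds P. has_valid_bound P r S \<theta>) \<longrightarrow>
        U_global P r S = (MAX \<theta>\<in>thresholds P. the (upper S \<theta>)) \<and>
        Z_inc P S \<le> Z_rob P \<and> Z_rob P \<le> U_global P r S \<and>
        0 \<le> Z_rob P - Z_inc P S \<and> Z_rob P - Z_inc P S \<le> U_global P r S - Z_inc P S)
     \<and>
     ((\<exists>\<theta>\<in>thresholds P. \<not> has_valid_bound P r S \<theta>) \<longrightarrow>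
        U_global P r S = \<infinity> \<and> U_global P r S - Z_inc P S = \<infinity>)"
proof (intro conjI impI)
  have budget: "budget P \<le> num_items P" using assms(1) by (simp add: pricing_data_def)
  {
    assume "\<forall>\<theta>\<in>thresholds P. integer_safe P \<theta> (r \<theta>) (R \<theta>)"
      and "(alg_step P r R)\<^sup>*\<^sup>* initial_state S"
      and "\<forall>\<theta>\<in>thresholds P. \<theta> \<notin> pruned_thresholds S \<longrightarrow> search_completed (R \<theta>) (searches S \<theta>)"
    then show eq: "Z_inc P S = Z_rob P" by (rule completed_algorithm_optimal[OF budget])
    show "\<exists>x. best_incumbent P S x" if "robust_feasible P \<noteq> {}"
      using best_incumbent_exists[OF eq that] .
    show "\<forall>x. best_incumbent P S x \<longrightarrow> globally_optimal P x"
      using best_incumbent_optimal[OF eq] by blast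
  }
  {
    assume "\<forall>\<theta>\<in>thresholds P. has_valid_bound P r S \<theta>"
    then show "U_global P r S = (MAX \<theta>\<in>thresholds P. the (upper S \<theta>))"
      unfolding U_global_def by (intro arg_cong[where f = Max] image_cong) (auto simp: U_eff_def)
  }
  show "Z_inc P S \<le> Z_rob P" by (rule Z_inc_le_Z_rob)
  show "Z_rob P \<le> U_global P r S" by (rule Z_rob_le_U_global[OF budget])
  then show "Z_rob P - Z_inc P S \<le> U_global P r S - Z_inc P S"
    by (rule ereal_minus_mono) simp
  show "0 \<le> Z_rob P - Z_inc P S" by (rule gap_nonneg)
  {
    assume "\<exists>\<theta>\<in>thresholds P. \<not> has_valid_bound P r S \<theta>"
    then obtain \<theta> where \<theta>: "\<theta> \<in> thresholds P" "U_eff P r S \<theta> = \<infinity>" by (auto simp: U_eff_def)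
    show "U_global P r S = \<infinity>" using U_eff_le_U_global[OF \<theta>(1), of r S] \<theta>(2) by simp
    then show "U_global P r S - Z_inc P S = \<infinity>" by simp
  }
qed

end
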